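(* Let $\Lambda$ be a $2$-dimensional lattice. Assume that $m=p_1^{r_1}\cdots p_l^{r_l}$ with $p_1,\dots,p_l$ distinct primes, $m_1=p_1^{t_1}\cdots p_l^{t_l}$ and $m_2=p_1^{r_1-t_1}\cdots p_l^{r_l-t_l}$, where the $t_k$ are nonnegative integers with $2t_k\le r_k$ for $1\le k\le l$. Then $$f(m_1,m_2)=\prod_{1\le k\le l,\ t_k\ne\frac{r_k}{2}}\left(p_k^{r_k-2t_k}+p_k^{r_k-2t_k-1}\right).$$
   Context: A $2$-dimensional lattice is the $\mathbb{Z}$-span of $2$ linearly independent vectors in a Euclidean space; a sublattice of $\Lambda$ is a subset of $\Lambda$ which is itself a $2$-dimensional lattice. A coefficient matrix of a sublattice $\Lambda^*$ is the integer matrix whose rows are the coordinates, in a basis of $\Lambda$, of the vectors of a basis of $\Lambda^*$. The invariant factors of $\Lambda^*$ are the diagonal entries $d_1\mid d_2$ (positive integers) of the Smith normal form of a coefficient matrix; they do not depend on the choices of bases. Two sublattices $\Lambda^*,\Lambda^\bullet$ of $\Lambda$ are unimodular equivalent if there is a linear transformation $\sigma$ with $\sigma(\Lambda)=\Lambda$ and $\sigma(\Lambda^* )=\Lambda^\bullet$; this holds if and only if their invariant factors coincide. For positive integers $d_1\mid d_2$, $f(d_1,d_2)$ is the cardinality of the unimodular equivalence class of all sublattices of $\Lambda$ with invariant factors $d_1,d_2$. An empty product equals $1$. *)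

theory Defs
  imports "HOL-Analysis.Analysis" "HOL-Computational_Algebra.Primes"
begin

definition lattice_basis :: "'a::euclidean_space set \<Rightarrow> (2 \<Rightarrow> 'a) \<Rightarrow> bool" where
  "lattice_basis L b \<longleftrightarrow>
     inj b \<and> independent (range b) \<and>
     L = range (\<lambda>x :: 2 \<Rightarrow> int. \<Sum>i\<in>UNIV. of_int (x i) *\<^sub>R b i)"

definition is_lattice2 :: "'a::euclidean_space set \<Rightarrow> bool" where
  "is_lattice2 L \<longleftrightarrow> (\<exists>b. lattice_basis L b)"

definition sublattice :: "'a::euclidean_space set \<Rightarrow> 'a set \<Rightarrow> bool" where
  "sublattice M L \<longleftrightarrow> M \<subseteq> L \<and> is_lattice2 M"

definition coefficient_matrix ::
  "'a::euclidean_space set \<Rightarrow> 'a set \<Rightarrow> int ^ 2 ^ 2 \<Rightarrow> bool" where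
  "coefficient_matrix L M A \<longleftrightarrow>
     (\<exists>b c. lattice_basis L b \<and> lattice_basis M c \<and>
        (\<forall>i. c i = (\<Sum>j\<in>UNIV. of_int (A $ i $ j) *\<^sub>R b j)))"

(* invertible is meant over the integers here, so P and Q are unimodular. *)
definition smith_normal_form :: "int ^ 2 ^ 2 \<Rightarrow> int ^ 2 ^ 2 \<Rightarrow> bool" where
  "smith_normal_form A D \<longleftrightarrow>
     (\<exists>P Q. invertible P \<and> invertible Q \<and> D = P ** A ** Q) \<and>
     D $ 1 $ 2 = 0 \<and> D $ 2 $ 1 = 0 \<and>
     0 \<le> D $ 1 $ 1 \<and> 0 \<le> D $ 2 $ 2 \<and> D $ 1 $ 1 dvd D $ 2 $ 2"

definition invariant_factors ::
  "'a::euclidean_space set \<Rightarrow> 'a set \<Rightarrow> nat \<Rightarrow> nat \<Rightarrow> bool" where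
  "invariant_factors L M d1 d2 \<longleftrightarrow>
     0 < d1 \<and> 0 < d2 \<and>
     (\<exists>A D. coefficient_matrix L M A \<and> smith_normal_form A D \<and>
        D $ 1 $ 1 = int d1 \<and> D $ 2 $ 2 = int d2)"

definition unimodular_equiv :: "'a::euclidean_space set \<Rightarrow> ('a set \<times> 'a set) set" where
  "unimodular_equiv L =
     {(M, N). sublattice M L \<and> sublattice N L \<and>
        (\<exists>\<sigma> :: 'a \<Rightarrow> 'a. linear \<sigma> \<and> \<sigma> ` L = L \<and> \<sigma> ` M = N)}"

(* The description is proper for a lattice L and positive d1 dvd d2, because two
   sublattices are unimodular equivalent iff their invariant factors coincide. *)
definition unimodular_class :: "'a::euclidean_space set \<Rightarrow> nat \<Rightarrow> nat \<Rightarrow> 'a set set" where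
  "unimodular_class L d1 d2 =
     (THE C. C \<in> {M. sublattice M L} // unimodular_equiv L \<and>
        (\<forall>M\<in>C. invariant_factors L M d1 d2))"

definition class_size :: "'a::euclidean_space set \<Rightarrow> nat \<Rightarrow> nat \<Rightarrow> nat" where
  "class_size L d1 d2 = card (unimodular_class L d1 d2)"

end

theory Submission
  imports Defs "HOL-Number_Theory.Cong"
begin

text \<open>
  Reading the Smith normal form as a simultaneous change of basis in \<open>L\<close> and in \<open>M\<close>, a sublattice
  \<open>M\<close> of \<open>L\<close> has invariant factors \<open>d1\<close>, \<open>d2\<close> exactly if some basis \<open>(u, v)\<close> of \<open>L\<close> is adapted to
  it: \<open>M\<close> is spanned by \<open>d1 u\<close> and \<open>d2 v\<close>. Since the linear maps preserving \<open>L\<close> permute its bases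
  transitively, the sublattices with an adapted basis form a single unimodular class
  (\<open>unimodular_class_eq_adapted\<close>), and it remains to count them.

  Write \<open>d2 = d1 e\<close>. Dividing by \<open>d1\<close> and passing to coordinates turns the members of the class into
  the subgroups of the integer plane spanned by \<open>b1\<close> and \<open>e b2\<close> for a basis \<open>(b1, b2)\<close> of the plane.
  Such a subgroup is cut out by a single congruence: it consists of the points whose coordinate
  along \<open>b2\<close> is divisible by \<open>e\<close>, and this coordinate is a linear form \<open>u x + v y\<close> with \<open>u\<close> and \<open>v\<close>
  coprime (\<open>adapted_eq_image_cocyclic\<close>). Two such congruences have the same solutions exactly if
  \<open>e\<close> divides the determinant of the two forms, so the class is in bijection with the projective line
  over the integers modulo \<open>e\<close>.

  By the Chinese remainder theorem the number of points of this projective line is multiplicative in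
  \<open>e\<close> (\<open>card_cocyclic_lattices_mult\<close>). For a prime power \<open>p ^ s\<close> with \<open>s > 0\<close>, at least one of the two
  coefficients is invertible and can be scaled to 1, which leaves the points \<open>(1 : y)\<close> and the points
  \<open>(p x : 1)\<close>, altogether \<open>p ^ s + p ^ (s - 1)\<close> of them (\<open>card_cocyclic_lattices_prime_power\<close>). Here
  \<open>e = m2 / m1\<close> is the product of the powers of \<open>p k\<close> with exponents \<open>r k - 2 * t k\<close>; a vanishing
  exponent contributes the factor 1.
\<close>

section \<open>Bases as pairs of vectors\<close>

definition indep2 :: "'a::real_vector \<Rightarrow> 'a \<Rightarrow> bool" where
  "indep2 u v \<longleftrightarrow> (\<forall>r s. r *\<^sub>R u + s *\<^sub>R v = 0 \<longrightarrow> r = 0 \<and> s = 0)"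

definition int_span :: "'a::real_vector \<Rightarrow> 'a \<Rightarrow> 'a set" where
  "int_span u v = {of_int x *\<^sub>R u + of_int y *\<^sub>R v | x y. True}"

definition basis2 :: "'a::real_vector set \<Rightarrow> 'a \<Rightarrow> 'a \<Rightarrow> bool" where
  "basis2 L u v \<longleftrightarrow> indep2 u v \<and> L = int_span u v"

lemma indep2_iff: "indep2 u v \<longleftrightarrow> u \<noteq> v \<and> independent {u, v}"
proof
  assume i: "indep2 u v"
  have "u \<noteq> v"
    using i[unfolded indep2_def, rule_format, of 1 "-1"] by auto
  moreover have "v \<noteq> 0"
    using i[unfolded indep2_def, rule_format, of 0 1] by auto
  moreover have "u \<notin> span {v}"
  proof
    assume "u \<in> span {v}"
    then obtain k where "u = k *\<^sub>R v" by (auto simp: span_singleton)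
    then show False
      using i[unfolded indep2_def, rule_format, of 1 "-k"] by auto
  qed
  ultimately show "u \<noteq> v \<and> independent {u, v}"
    by (simp add: independent_insert)
next
  assume a: "u \<noteq> v \<and> independent {u, v}"
  then have u: "u \<notin> span {v}" and v: "v \<noteq> 0"
    by (auto simp: independent_insert split: if_splits)
  show "indep2 u v"
    unfolding indep2_def
  proof (intro allI impI)
    fix r s assume z: "r *\<^sub>R u + s *\<^sub>R v = 0"
    have "r = 0"
    proof (rule ccontr)
      assume r: "r \<noteq> 0"
      have "r *\<^sub>R u = (-s) *\<^sub>R v" using z by (simp add: eq_neg_iff_add_eq_0)
      then have "(1/r) *\<^sub>R (r *\<^sub>R u) = (1/r) *\<^sub>R ((-s) *\<^sub>R v)" by simp
      then have "u = (-s/r) *\<^sub>R v" using r by simp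
      then show False using u unfolding span_singleton by blast
    qed
    then show "r = 0 \<and> s = 0" using z v by simp
  qed
qed

lemma lattice_basis_iff_basis2: "lattice_basis L b \<longleftrightarrow> basis2 L (b 1) (b 2)"
proof -
  have one_neq_two: "(1::2) \<noteq> 2" by simp
  have "inj b \<longleftrightarrow> b 1 \<noteq> b 2"
    unfolding inj_def by (metis exhaust_2 one_neq_two)
  moreover have "range b = {b 1, b 2}"
    by (auto simp: UNIV_2)
  moreover have "range (\<lambda>x :: 2 \<Rightarrow> int. \<Sum>i\<in>UNIV. of_int (x i) *\<^sub>R b i) = int_span (b 1) (b 2)"
  proof
    show "range (\<lambda>x :: 2 \<Rightarrow> int. \<Sum>i\<in>UNIV. of_int (x i) *\<^sub>R b i) \<subseteq> int_span (b 1) (b 2)"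
      by (auto simp: int_span_def sum_2)
    show "int_span (b 1) (b 2) \<subseteq> range (\<lambda>x :: 2 \<Rightarrow> int. \<Sum>i\<in>UNIV. of_int (x i) *\<^sub>R b i)"
    proof
      fix z assume "z \<in> int_span (b 1) (b 2)"
      then obtain x y :: int where z: "z = of_int x *\<^sub>R b 1 + of_int y *\<^sub>R b 2"
        by (auto simp: int_span_def)
      show "z \<in> range (\<lambda>x :: 2 \<Rightarrow> int. \<Sum>i\<in>UNIV. of_int (x i) *\<^sub>R b i)"
        by (rule image_eqI[of _ _ "\<lambda>i. if i = 1 then x else y"]) (simp_all add: z sum_2)
    qed
  qed
  ultimately show ?thesis
    by (auto simp: lattice_basis_def basis2_def indep2_iff)
qed

lemma is_lattice2_iff_basis2: "is_lattice2 L \<longleftrightarrow> (\<exists>u v. basis2 L u v)"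
proof
  assume "\<exists>u v. basis2 L u v"
  then obtain u v where "basis2 L u v" by blast
  then have "lattice_basis L (\<lambda>i::2. if i = 1 then u else v)"
    by (simp add: lattice_basis_iff_basis2)
  then show "is_lattice2 L" unfolding is_lattice2_def by blast
qed (auto simp: is_lattice2_def lattice_basis_iff_basis2)

lemma int_spanI: "of_int x *\<^sub>R u + of_int y *\<^sub>R v \<in> int_span u v"
  by (auto simp: int_span_def)

lemma int_span_generators: "u \<in> int_span u v" "v \<in> int_span u v"
  using int_spanI[of 1 u 0 v] int_spanI[of 0 u 1 v] by auto

lemma int_span_subset:
  assumes "u \<in> int_span u' v'" "v \<in> int_span u' v'"
  shows "int_span u v \<subseteq> int_span u' v'"
proof
  fix z assume "z \<in> int_span u v"
  then obtain x y where z: "z = of_int x *\<^sub>R u + of_int y *\<^sub>R v"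
    by (auto simp: int_span_def)
  obtain a b where u: "u = of_int a *\<^sub>R u' + of_int b *\<^sub>R v'"
    using assms(1) by (auto simp: int_span_def)
  obtain c d where v: "v = of_int c *\<^sub>R u' + of_int d *\<^sub>R v'"
    using assms(2) by (auto simp: int_span_def)
  have "z = of_int (x*a + y*c) *\<^sub>R u' + of_int (x*b + y*d) *\<^sub>R v'"
    by (simp add: z u v algebra_simps)
  then show "z \<in> int_span u' v'" using int_spanI by metis
qed

text \<open>
  Two vectors that combine to two independent ones are independent themselves. By Cramer's rule a
  relation \<open>r u + s v = 0\<close>, multiplied by the determinant \<open>D\<close> of the combinations, becomes a relation
  between the latter, whose coefficients must vanish; solving them for \<open>r D\<close> and \<open>s D\<close> gives the
  claim once \<open>D \<noteq> 0\<close>.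
\<close>

lemma indep2_of_combinations:
  fixes u v :: "'a::real_vector"
  assumes i: "indep2 (a *\<^sub>R u + b *\<^sub>R v) (c *\<^sub>R u + d *\<^sub>R v)"
  shows "indep2 u v"
  unfolding indep2_def
proof (intro allI impI)
  fix r s assume z: "r *\<^sub>R u + s *\<^sub>R v = 0"
  note I = i[unfolded indep2_def, rule_format]
  let ?D = "a * d - b * c"
  \<comment> \<open>If \<open>D = 0\<close>, the rows of the adjugate matrix give relations between the two combinations, so all four coefficients vanish.\<close>
  have D: "?D \<noteq> 0"
  proof
    assume 0: "?D = 0"
    have "d *\<^sub>R (a *\<^sub>R u + b *\<^sub>R v) + (-b) *\<^sub>R (c *\<^sub>R u + d *\<^sub>R v) = ?D *\<^sub>R u"
      by (simp add: algebra_simps)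
    with I[of d "-b"] 0 have db: "d = 0" "b = 0" by auto
    have "(-c) *\<^sub>R (a *\<^sub>R u + b *\<^sub>R v) + a *\<^sub>R (c *\<^sub>R u + d *\<^sub>R v) = ?D *\<^sub>R v"
      by (simp add: algebra_simps)
    with I[of "-c" a] 0 have "a = 0" by auto
    with I[of 1 0] db show False by auto
  qed
  have "(r*d - s*c) *\<^sub>R (a *\<^sub>R u + b *\<^sub>R v) + (s*a - r*b) *\<^sub>R (c *\<^sub>R u + d *\<^sub>R v)
      = ?D *\<^sub>R (r *\<^sub>R u + s *\<^sub>R v)"
    by (simp add: algebra_simps)
  then have e: "r*d - s*c = 0" "s*a - r*b = 0"
    using I[of "r*d - s*c" "s*a - r*b"] z by auto
  have "r * ?D = a * (r*d - s*c) + c * (s*a - r*b)"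
       "s * ?D = b * (r*d - s*c) + d * (s*a - r*b)" by algebra+
  then have "r * ?D = 0" "s * ?D = 0" unfolding e by simp_all
  then show "r = 0 \<and> s = 0" using D by (simp only: mult_eq_0_iff) simp
qed

text \<open>
  Two generators of a lattice of rank two are automatically independent. This spares every later
  change of basis a separate proof of independence.
\<close>

lemma basis2_of_generators:
  assumes b: "basis2 L u v" and L: "L = int_span u' v'"
  shows "basis2 L u' v'"
proof -
  have "u \<in> int_span u' v'" "v \<in> int_span u' v'"
    using b L int_span_generators[where u = u and v = v] unfolding basis2_def by auto
  then obtain x y z w :: int where
    "u = of_int x *\<^sub>R u' + of_int y *\<^sub>R v'" "v = of_int z *\<^sub>R u' + of_int w *\<^sub>R v'"
    by (auto simp: int_span_def)
  with b have "indep2 u' v'"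
    using indep2_of_combinations[of "of_int x" u' "of_int y" v' "of_int z" "of_int w"]
    by (simp add: basis2_def)
  then show ?thesis using L by (simp add: basis2_def)
qed

lemma indep2_scale:
  assumes "indep2 u v" "r \<noteq> 0" "s \<noteq> 0"
  shows "indep2 (r *\<^sub>R u) (s *\<^sub>R v)"
  unfolding indep2_def
proof (intro allI impI)
  fix x y assume "x *\<^sub>R r *\<^sub>R u + y *\<^sub>R s *\<^sub>R v = 0"
  then have "(x * r) *\<^sub>R u + (y * s) *\<^sub>R v = 0" by simp
  with assms(1) have "x * r = 0 \<and> y * s = 0" unfolding indep2_def by blast
  then show "x = 0 \<and> y = 0" using assms by auto
qed

lemma indep2_coords_unique:
  assumes "indep2 u v" "x *\<^sub>R u + y *\<^sub>R v = x' *\<^sub>R u + y' *\<^sub>R v"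
  shows "x = x' \<and> y = y'"
proof -
  have "(x - x') *\<^sub>R u + (y - y') *\<^sub>R v = 0"
    using assms(2) by (simp add: algebra_simps)
  with assms(1) have "x - x' = 0 \<and> y - y' = 0" unfolding indep2_def by blast
  then show ?thesis by simp
qed

lemma basis2_unimodular:
  fixes a b c d :: int
  assumes L: "basis2 L u v" and D: "is_unit (a * d - b * c)"
  shows "basis2 L (of_int a *\<^sub>R u + of_int b *\<^sub>R v) (of_int c *\<^sub>R u + of_int d *\<^sub>R v)"
    (is "basis2 L ?u ?v")
proof -
  obtain k where k: "1 = (a * d - b * c) * k" using D by (rule dvdE)
  have "int_span ?u ?v \<subseteq> int_span u v"
    by (intro int_span_subset int_spanI)
  moreover have "int_span u v \<subseteq> int_span ?u ?v"
  proof (rule int_span_subset)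
    \<comment> \<open>Invert the change of basis by its adjugate, scaled by the inverse \<open>k\<close> of the determinant.\<close>
    have "of_int (k * d) *\<^sub>R ?u + of_int (- (k * b)) *\<^sub>R ?v = of_int ((a * d - b * c) * k) *\<^sub>R u"
      by (simp add: algebra_simps)
    then show "u \<in> int_span ?u ?v"
      using int_spanI[of "k * d" ?u "- (k * b)" ?v] k by simp
    have "of_int (- (k * c)) *\<^sub>R ?u + of_int (k * a) *\<^sub>R ?v = of_int ((a * d - b * c) * k) *\<^sub>R v"
      by (simp add: algebra_simps)
    then show "v \<in> int_span ?u ?v"
      using int_spanI[of "- (k * c)" ?u "k * a" ?v] k by simp
  qed
  ultimately have "int_span u v = int_span ?u ?v" by (rule equalityI[rotated])
  then show ?thesis using L basis2_of_generators[OF L, of ?u ?v] unfolding basis2_def by metis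
qed

text \<open>
  The matrices of the two changes of basis, from \<open>(u, v)\<close> to \<open>(u', v')\<close> and back, are inverse to each
  other because coordinates are unique, so their determinants multiply to 1.
\<close>

lemma basis2_change_unimodular:
  assumes L: "basis2 L u v" and L': "basis2 L u' v'"
  obtains a b c d :: int where
    "u' = of_int a *\<^sub>R u + of_int b *\<^sub>R v" "v' = of_int c *\<^sub>R u + of_int d *\<^sub>R v"
    "is_unit (a * d - b * c)"
proof -
  have "u' \<in> int_span u v" "v' \<in> int_span u v" "u \<in> int_span u' v'" "v \<in> int_span u' v'"
    using L L' int_span_generators unfolding basis2_def by metis+
  then obtain a b c d a' b' c' d' :: int where
    e: "u' = of_int a *\<^sub>R u + of_int b *\<^sub>R v" "v' = of_int c *\<^sub>R u + of_int d *\<^sub>R v"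
    and e': "u = of_int a' *\<^sub>R u' + of_int b' *\<^sub>R v'" "v = of_int c' *\<^sub>R u' + of_int d' *\<^sub>R v'"
    unfolding int_span_def by blast
  have i: "indep2 u v" using L by (simp add: basis2_def)
  have "of_int (a'*a + b'*c) *\<^sub>R u + of_int (a'*b + b'*d) *\<^sub>R v
      = of_int a' *\<^sub>R u' + of_int b' *\<^sub>R v'"
    by (simp add: e algebra_simps)
  also have "\<dots> = 1 *\<^sub>R u + 0 *\<^sub>R v" using e'(1) by simp
  finally have "of_int (a'*a + b'*c) *\<^sub>R u + of_int (a'*b + b'*d) *\<^sub>R v = 1 *\<^sub>R u + 0 *\<^sub>R v" .
  from indep2_coords_unique[OF i this] have 1: "a'*a + b'*c = 1" "a'*b + b'*d = 0"
    by linarith+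
  have "of_int (c'*a + d'*c) *\<^sub>R u + of_int (c'*b + d'*d) *\<^sub>R v
      = of_int c' *\<^sub>R u' + of_int d' *\<^sub>R v'"
    by (simp add: e algebra_simps)
  also have "\<dots> = 0 *\<^sub>R u + 1 *\<^sub>R v" using e'(2) by simp
  finally have "of_int (c'*a + d'*c) *\<^sub>R u + of_int (c'*b + d'*d) *\<^sub>R v = 0 *\<^sub>R u + 1 *\<^sub>R v" .
  from indep2_coords_unique[OF i this] have 2: "c'*a + d'*c = 0" "c'*b + d'*d = 1"
    by linarith+
  have "(a*d - b*c) * (a'*d' - b'*c')
      = (a'*a + b'*c) * (c'*b + d'*d) - (a'*b + b'*d) * (c'*a + d'*c)" by algebra
  then have "1 = (a*d - b*c) * (a'*d' - b'*c')" using 1 2 by simp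
  then have "is_unit (a*d - b*c)" by (rule dvdI)
  with e show ?thesis by (rule that)
qed

section \<open>Unimodular classes through adapted bases\<close>

definition adapted_sublattices :: "'a::real_vector set \<Rightarrow> nat \<Rightarrow> nat \<Rightarrow> 'a set set" where
  "adapted_sublattices L d1 d2 =
     {int_span (of_nat d1 *\<^sub>R u) (of_nat d2 *\<^sub>R v) | u v. basis2 L u v}"

lemma is_unit_det_of_invertible:
  fixes P :: "int ^ 2 ^ 2"
  assumes "invertible P"
  shows "is_unit (P$1$1 * P$2$2 - P$1$2 * P$2$1)"
proof -
  obtain P' where "P ** P' = mat 1" using assms by (auto simp: invertible_def)
  then have "det P * det P' = 1" by (metis det_mul det_I)
  then show ?thesis unfolding det_2[symmetric] by (metis dvdI)
qed

text \<open>
  If \<open>D = P A Q\<close> and \<open>R\<close> is the inverse of \<open>Q\<close>, then \<open>P A = D R\<close>: applying \<open>P\<close> to the basis of \<open>M\<close> gives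
  the same vectors as applying \<open>D\<close> to the basis of \<open>L\<close> transformed by \<open>R\<close>. Since \<open>D\<close> is diagonal, these
  are multiples of the transformed basis vectors.
\<close>

lemma adapted_of_invariant_factors:
  assumes "invariant_factors L M d1 d2"
  shows "M \<in> adapted_sublattices L d1 d2"
proof -
  obtain A D where A: "coefficient_matrix L M A" and sm: "smith_normal_form A D"
    and D: "D$1$1 = int d1" "D$2$2 = int d2"
    using assms by (auto simp: invariant_factors_def)
  obtain b c :: "2 \<Rightarrow> 'a" where b: "basis2 L (b 1) (b 2)" and c: "basis2 M (c 1) (c 2)"
    and bc: "\<And>i. c i = of_int (A$i$1) *\<^sub>R b 1 + of_int (A$i$2) *\<^sub>R b 2"
    using A by (auto simp: coefficient_matrix_def lattice_basis_iff_basis2 sum_2)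
  obtain P Q where P: "invertible P" and Q: "invertible Q" and PAQ: "D = P ** A ** Q"
    and D0: "D$1$2 = 0" "D$2$1 = 0"
    using sm by (auto simp: smith_normal_form_def)
  obtain R where QR: "Q ** R = mat 1" "R ** Q = mat 1" using Q by (auto simp: invertible_def)
  have R: "invertible R" using QR by (auto simp: invertible_def)
  have "D ** R = P ** A"
    by (simp add: PAQ matrix_mul_assoc[symmetric] QR)
  then have "(P ** A) $ i $ j = (D ** R) $ i $ j" for i j by simp
  note e = this[unfolded matrix_matrix_mult_def, simplified, unfolded sum_2]
  define u v where "u = of_int (R$1$1) *\<^sub>R b 1 + of_int (R$1$2) *\<^sub>R b 2"
    and "v = of_int (R$2$1) *\<^sub>R b 1 + of_int (R$2$2) *\<^sub>R b 2"
  have uv: "basis2 L u v"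
    unfolding u_def v_def by (rule basis2_unimodular[OF b is_unit_det_of_invertible[OF R]])
  have row: "of_int (P$i$1) *\<^sub>R c 1 + of_int (P$i$2) *\<^sub>R c 2
      = of_int (D$i$1) *\<^sub>R u + of_int (D$i$2) *\<^sub>R v" for i
  proof -
    have "of_int (P$i$1) *\<^sub>R c 1 + of_int (P$i$2) *\<^sub>R c 2 =
      of_int (P$i$1 * A$1$1 + P$i$2 * A$2$1) *\<^sub>R b 1 + of_int (P$i$1 * A$1$2 + P$i$2 * A$2$2) *\<^sub>R b 2"
      by (simp add: bc algebra_simps)
    also have "\<dots> = of_int (D$i$1) *\<^sub>R u + of_int (D$i$2) *\<^sub>R v"
      unfolding e u_def v_def by (simp add: algebra_simps)
    finally show ?thesis .
  qed
  have "basis2 M (of_nat d1 *\<^sub>R u) (of_nat d2 *\<^sub>R v)"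
    using basis2_unimodular[OF c is_unit_det_of_invertible[OF P]] D D0 by (simp add: row)
  then show ?thesis using uv by (auto simp: adapted_sublattices_def basis2_def)
qed

lemma invariant_factors_of_adapted:
  assumes M: "M \<in> adapted_sublattices L d1 d2" and pos: "0 < d1" "0 < d2" and "d1 dvd d2"
  shows "invariant_factors L M d1 d2" and "sublattice M L"
proof -
  obtain u v where L: "basis2 L u v" and Meq: "M = int_span (of_nat d1 *\<^sub>R u) (of_nat d2 *\<^sub>R v)"
    using M by (auto simp: adapted_sublattices_def)
  have M2: "basis2 M (of_nat d1 *\<^sub>R u) (of_nat d2 *\<^sub>R v)"
    using L pos Meq by (auto simp: basis2_def intro!: indep2_scale)
  define D :: "int^2^2" where
    "D = (\<chi> i j. if i = j then (if i = 1 then int d1 else int d2) else 0)"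
  have "coefficient_matrix L M D"
    unfolding coefficient_matrix_def lattice_basis_iff_basis2
    by (rule exI[of _ "\<lambda>i. if i = 1 then u else v"],
        rule exI[of _ "\<lambda>i. if i = 1 then of_nat d1 *\<^sub>R u else of_nat d2 *\<^sub>R v"])
      (use L M2 in \<open>auto simp: D_def sum_2 forall_2\<close>)
  moreover have "smith_normal_form D D"
  proof -
    have "invertible (mat 1 :: int^2^2)" unfolding invertible_def
      by (rule exI[of _ "mat 1"]) simp
    moreover have "D = mat 1 ** D ** mat 1" by simp
    ultimately have "\<exists>P Q. invertible P \<and> invertible Q \<and> D = P ** D ** Q" by blast
    moreover have "D$1$2 = 0" "D$2$1 = 0" "D$1$1 = int d1" "D$2$2 = int d2"
      by (simp_all add: D_def)
    ultimately show ?thesis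
      using \<open>d1 dvd d2\<close> unfolding smith_normal_form_def by simp
  qed
  moreover have "D$1$1 = int d1" "D$2$2 = int d2" by (simp_all add: D_def)
  ultimately show "invariant_factors L M d1 d2"
    unfolding invariant_factors_def using pos by blast
  have "M \<subseteq> L"
  proof -
    have "of_int (int d1) *\<^sub>R u + of_int 0 *\<^sub>R v \<in> L" "of_int 0 *\<^sub>R u + of_int (int d2) *\<^sub>R v \<in> L"
      using L int_spanI unfolding basis2_def by metis+
    then show ?thesis using L by (auto simp: basis2_def Meq dest: int_span_subset)
  qed
  then show "sublattice M L" using M2 by (auto simp: sublattice_def is_lattice2_iff_basis2)
qed

lemma linear_image_int_span:
  assumes "linear \<sigma>"
  shows "\<sigma> ` int_span u v = int_span (\<sigma> u) (\<sigma> v)"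
proof -
  have "\<sigma> (of_int x *\<^sub>R u + of_int y *\<^sub>R v) = of_int x *\<^sub>R \<sigma> u + of_int y *\<^sub>R \<sigma> v" for x y
    using assms by (simp add: linear_add linear_scale)
  then show ?thesis unfolding int_span_def by (force simp: image_iff)
qed

text \<open>
  A linear map \<open>\<sigma>\<close> with \<open>\<sigma> ` L = L\<close> takes an adapted basis of \<open>M\<close> to an adapted basis of \<open>\<sigma> ` M\<close>.
  Conversely, any two bases of \<open>L\<close> are related by a linear map of the whole space, which then
  matches the sublattices adapted to them.
\<close>

lemma unimodular_equiv_image_adapted:
  assumes M: "M \<in> adapted_sublattices L d1 d2" and pos: "0 < d1" "0 < d2" and "d1 dvd d2"
  shows "unimodular_equiv L `` {M} = adapted_sublattices L d1 d2"
proof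
  obtain u v where L: "basis2 L u v" and Meq: "M = int_span (of_nat d1 *\<^sub>R u) (of_nat d2 *\<^sub>R v)"
    using M by (auto simp: adapted_sublattices_def)
  show "unimodular_equiv L `` {M} \<subseteq> adapted_sublattices L d1 d2"
  proof
    fix N assume "N \<in> unimodular_equiv L `` {M}"
    then obtain \<sigma> :: "'a \<Rightarrow> 'a" where s: "linear \<sigma>" "\<sigma> ` L = L" "\<sigma> ` M = N"
      by (auto simp: unimodular_equiv_def)
    have "L = int_span (\<sigma> u) (\<sigma> v)"
      using s L by (metis linear_image_int_span basis2_def)
    with L have "basis2 L (\<sigma> u) (\<sigma> v)" by (rule basis2_of_generators)
    moreover have "N = int_span (of_nat d1 *\<^sub>R \<sigma> u) (of_nat d2 *\<^sub>R \<sigma> v)"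
      using s Meq by (metis linear_image_int_span linear_scale)
    ultimately show "N \<in> adapted_sublattices L d1 d2" by (auto simp: adapted_sublattices_def)
  qed
  show "adapted_sublattices L d1 d2 \<subseteq> unimodular_equiv L `` {M}"
  proof
    fix N assume N: "N \<in> adapted_sublattices L d1 d2"
    then obtain u' v' where L': "basis2 L u' v'"
      and Neq: "N = int_span (of_nat d1 *\<^sub>R u') (of_nat d2 *\<^sub>R v')"
      by (auto simp: adapted_sublattices_def)
    have uv: "u \<noteq> v" "independent {u, v}" using L by (auto simp: basis2_def indep2_iff)
    obtain \<sigma> where s: "linear \<sigma>" and on: "\<forall>x\<in>{u, v}. \<sigma> x = (if x = u then u' else v')"
      using linear_independent_extend[OF uv(2), of "\<lambda>x. if x = u then u' else v'"] by blast
    have uv': "\<sigma> u = u'" "\<sigma> v = v'" using on uv(1) by auto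
    have "\<sigma> ` L = L"
      using L L' s uv' by (metis linear_image_int_span basis2_def)
    moreover have "\<sigma> ` M = N"
      using s uv' by (simp add: Meq Neq linear_image_int_span linear_scale)
    ultimately show "N \<in> unimodular_equiv L `` {M}"
      using s invariant_factors_of_adapted(2)[OF M pos \<open>d1 dvd d2\<close>]
        invariant_factors_of_adapted(2)[OF N pos \<open>d1 dvd d2\<close>]
      by (auto simp: unimodular_equiv_def)
  qed
qed

text \<open>
  Any class with the required invariant factors contains a sublattice with an adapted basis, and the
  class of such a sublattice is the whole set; hence the definite description picks this set.
\<close>

lemma unimodular_class_eq_adapted:
  assumes L: "is_lattice2 L" and pos: "0 < d1" "0 < d2" and dvd: "d1 dvd d2"
  shows "unimodular_class L d1 d2 = adapted_sublattices L d1 d2"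
  unfolding unimodular_class_def
proof (rule the_equality)
  obtain u v where uv: "basis2 L u v" using L by (auto simp: is_lattice2_iff_basis2)
  then obtain M where M: "M \<in> adapted_sublattices L d1 d2" by (auto simp: adapted_sublattices_def)
  show "adapted_sublattices L d1 d2 \<in> {M. sublattice M L} // unimodular_equiv L \<and>
      (\<forall>M\<in>adapted_sublattices L d1 d2. invariant_factors L M d1 d2)"
  proof
    have "M \<in> {M. sublattice M L}" using invariant_factors_of_adapted(2)[OF M pos dvd] by simp
    then show "adapted_sublattices L d1 d2 \<in> {M. sublattice M L} // unimodular_equiv L"
      unfolding unimodular_equiv_image_adapted[OF M pos dvd, symmetric] by (rule quotientI)
  qed (use invariant_factors_of_adapted(1)[OF _ pos dvd] in blast)
next
  fix C
  assume C: "C \<in> {M. sublattice M L} // unimodular_equiv L \<and> (\<forall>M\<in>C. invariant_factors L M d1 d2)"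
  then obtain M where M: "sublattice M L" and CM: "C = unimodular_equiv L `` {M}"
    by (auto simp: quotient_def)
  have "linear (id :: 'a \<Rightarrow> 'a)" by (rule linear_id)
  then have "M \<in> C" using M unfolding CM unimodular_equiv_def by force
  then have "M \<in> adapted_sublattices L d1 d2" using C by (auto intro: adapted_of_invariant_factors)
  then show "C = adapted_sublattices L d1 d2"
    unfolding CM by (rule unimodular_equiv_image_adapted[OF _ pos dvd])
qed

section \<open>Congruence lattices in the integer plane\<close>

definition congruence_lattice :: "int \<Rightarrow> int \<Rightarrow> int \<Rightarrow> (int \<times> int) set" where
  "congruence_lattice e u v = {(x, y). e dvd u * x + v * y}"

text \<open>
  For positive \<open>e\<close> these are the subgroups of the integer plane whose quotient is cyclic of order \<open>e\<close>;
  as the forms are taken up to units modulo \<open>e\<close>, they are the points of the projective line over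
  the integers modulo \<open>e\<close>.
\<close>

definition cocyclic_lattices :: "int \<Rightarrow> (int \<times> int) set set" where
  "cocyclic_lattices e = {congruence_lattice e u v | u v. coprime u v}"

text \<open>
  Modulo \<open>e\<close> the two forms are proportional: if \<open>i u + j v = 1\<close>, the second form is \<open>i u' + j v'\<close>
  times the first, up to a multiple of their determinant.
\<close>

lemma congruence_lattice_subsetI:
  assumes c: "coprime u v" and d: "e dvd u * v' - v * u'"
  shows "congruence_lattice e u v \<subseteq> congruence_lattice e u' v'"
proof
  fix z assume "z \<in> congruence_lattice e u v"
  then obtain x y where z: "z = (x, y)" "e dvd u * x + v * y" by (auto simp: congruence_lattice_def)
  obtain i j where ij: "i * u + j * v = 1" using c by (metis bezout_int coprime_imp_gcd_eq_1)
  let ?w = "u' * x + v' * y"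
  have "?w = (i * u + j * v) * ?w" by (simp add: ij)
  also have "\<dots> = (i * u' + j * v') * (u * x + v * y) + (i * y - j * x) * (u * v' - v * u')"
    by algebra
  finally have "e dvd ?w" using z(2) d by (simp add: dvd_add)
  then show "z \<in> congruence_lattice e u' v'" by (simp add: z congruence_lattice_def)
qed

text \<open>
  The point \<open>(v, -u)\<close> solves the first congruence, and its value under the second form is, up to sign,
  the determinant; so the divisibility is necessary as well.
\<close>

lemma congruence_lattice_eq_iff:
  assumes "coprime u v" "coprime u' v'"
  shows "congruence_lattice e u v = congruence_lattice e u' v' \<longleftrightarrow> e dvd u * v' - v * u'"
proof
  assume eq: "congruence_lattice e u v = congruence_lattice e u' v'"
  have "(v, -u) \<in> congruence_lattice e u v" by (simp add: congruence_lattice_def)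
  then have "e dvd u' * v + v' * (-u)" unfolding eq by (simp add: congruence_lattice_def)
  moreover have "u * v' - v * u' = - (u' * v + v' * (-u))" by simp
  ultimately show "e dvd u * v' - v * u'" by (simp only: dvd_minus_iff)
next
  assume d: "e dvd u * v' - v * u'"
  have "u' * v - v' * u = - (u * v' - v * u')" by simp
  with d have "e dvd u' * v - v' * u" by (simp only: dvd_minus_iff)
  with d assms show "congruence_lattice e u v = congruence_lattice e u' v'"
    by (intro equalityI congruence_lattice_subsetI)
qed

lemma congruence_lattice_cong:
  assumes "[u = u'] (mod e)" "[v = v'] (mod e)"
  shows "congruence_lattice e u v = congruence_lattice e u' v'"
proof -
  have "e dvd u * x + v * y \<longleftrightarrow> e dvd u' * x + v' * y" for x y
    by (rule cong_dvd_iff) (use assms in \<open>intro cong_add cong_mult cong_refl\<close>)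
  then show ?thesis by (simp add: congruence_lattice_def)
qed

text \<open>
  Residues modulo \<open>e\<close> seldom come with coprime representatives, but a common factor of \<open>u\<close> and \<open>v\<close>
  that is prime to \<open>e\<close> can be cancelled from the congruence.
\<close>

lemma congruence_lattice_in_cocyclic:
  assumes c: "coprime (gcd u v) e"
  shows "congruence_lattice e u v \<in> cocyclic_lattices e"
proof (cases "gcd u v = 0")
  case True
  \<comment> \<open>A vanishing form can occur only modulo a unit, where every congruence is trivial.\<close>
  with c have "is_unit e" by simp
  then have "congruence_lattice e u v = congruence_lattice e 1 0"
    using dvd_trans[of e 1] by (auto simp: congruence_lattice_def)
  then show ?thesis by (force simp: cocyclic_lattices_def)
next
  case False
  then obtain u' v' where u: "u = u' * gcd u v" and v: "v = v' * gcd u v" and "coprime u' v'"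
    using gcd_coprime_exists by metis
  have "e dvd u * x + v * y \<longleftrightarrow> e dvd u' * x + v' * y" for x y
  proof -
    have "u * x + v * y = gcd u v * (u' * x + v' * y)"
      by (subst u, subst v) (simp add: algebra_simps)
    then show ?thesis using c by (metis coprime_commute coprime_dvd_mult_right_iff)
  qed
  then have "congruence_lattice e u v = congruence_lattice e u' v'"
    by (auto simp: congruence_lattice_def)
  with \<open>coprime u' v'\<close> show ?thesis by (auto simp: cocyclic_lattices_def)
qed

lemma congruence_lattice_mult:
  assumes "coprime a b"
  shows "congruence_lattice (a * b) u v = congruence_lattice a u v \<inter> congruence_lattice b u v"
  using assms by (auto simp: congruence_lattice_def intro: divides_mult dvd_mult_left dvd_mult_right)

text \<open>
  The Chinese remainder theorem, applied to each coefficient, merges a form modulo \<open>a\<close> and a form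
  modulo \<open>b\<close> into one form modulo \<open>a * b\<close>.
\<close>

lemma cocyclic_lattices_Int:
  assumes ab: "coprime a b" and A: "A \<in> cocyclic_lattices a" and B: "B \<in> cocyclic_lattices b"
  shows "A \<inter> B \<in> cocyclic_lattices (a * b)"
proof -
  obtain u1 v1 where A: "A = congruence_lattice a u1 v1" "coprime u1 v1"
    using A by (auto simp: cocyclic_lattices_def)
  obtain u2 v2 where B: "B = congruence_lattice b u2 v2" "coprime u2 v2"
    using B by (auto simp: cocyclic_lattices_def)
  obtain u where u: "[u = u1] (mod a)" "[u = u2] (mod b)"
    using binary_chinese_remainder_int[OF ab] by blast
  obtain v where v: "[v = v1] (mod a)" "[v = v2] (mod b)"
    using binary_chinese_remainder_int[OF ab] by blast
  have *: "coprime (gcd u v) c" if "[u = w] (mod c)" "[v = z] (mod c)" "coprime w z" for c w z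
  proof (rule coprimeI)
    fix d assume "d dvd gcd u v" "d dvd c"
    then have "d dvd w" "d dvd z"
      using that(1,2) by (metis cong_dvd_iff cong_dvd_modulus gcd_greatest_iff)+
    with that(3) show "is_unit d" by (rule coprime_common_divisor)
  qed
  have "coprime (gcd u v) (a * b)"
    using *[OF u(1) v(1) A(2)] *[OF u(2) v(2) B(2)] by simp
  then have "congruence_lattice (a * b) u v \<in> cocyclic_lattices (a * b)"
    by (rule congruence_lattice_in_cocyclic)
  also have "congruence_lattice (a * b) u v = A \<inter> B"
    by (simp only: congruence_lattice_mult[OF ab] A B congruence_lattice_cong[OF u(1) v(1)]
        congruence_lattice_cong[OF u(2) v(2)])
  finally show ?thesis .
qed

text \<open>
  Every multiple of \<open>b\<close> lies in \<open>B\<close>, and multiplication by \<open>b\<close> does not affect membership in \<open>A\<close> because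
  \<open>b\<close> is invertible modulo \<open>a\<close>. Hence \<open>A\<close> can be recovered from \<open>A \<inter> B\<close>.
\<close>

lemma cocyclic_lattice_of_Int:
  assumes ab: "coprime a b" and A: "A \<in> cocyclic_lattices a" and B: "B \<in> cocyclic_lattices b"
  shows "A = {(x, y). (b * x, b * y) \<in> A \<inter> B}"
proof -
  obtain u1 v1 where A: "A = congruence_lattice a u1 v1"
    using A by (auto simp: cocyclic_lattices_def)
  obtain u2 v2 where B: "B = congruence_lattice b u2 v2"
    using B by (auto simp: cocyclic_lattices_def)
  have 1: "w * (b * x) + z * (b * y) = b * (w * x + z * y)" for w z x y
    by (simp add: algebra_simps)
  show ?thesis
    using ab by (auto simp: A B congruence_lattice_def 1 coprime_dvd_mult_right_iff)
qed

lemma card_cocyclic_lattices_mult: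
  assumes ab: "coprime a b"
  shows "card (cocyclic_lattices (a * b)) = card (cocyclic_lattices a) * card (cocyclic_lattices b)"
proof -
  let ?X = "cocyclic_lattices a \<times> cocyclic_lattices b"
  have ba: "coprime b a" using ab by (simp add: coprime_commute)
  have "inj_on (\<lambda>(A, B). A \<inter> B) ?X"
  proof (rule inj_onI, clarify)
    fix A B A' B'
    assume A: "A \<in> cocyclic_lattices a" "A' \<in> cocyclic_lattices a"
      and B: "B \<in> cocyclic_lattices b" "B' \<in> cocyclic_lattices b" and eq: "A \<inter> B = A' \<inter> B'"
    have "A = A'"
      by (subst cocyclic_lattice_of_Int[OF ab A(1) B(1)], subst cocyclic_lattice_of_Int[OF ab A(2) B(2)])
        (simp only: eq)
    moreover have "B = B'"
      by (subst cocyclic_lattice_of_Int[OF ba B(1) A(1)], subst cocyclic_lattice_of_Int[OF ba B(2) A(2)])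
        (simp only: eq Int_commute)
    ultimately show "A = A' \<and> B = B'" by simp
  qed
  moreover have "(\<lambda>(A, B). A \<inter> B) ` ?X = cocyclic_lattices (a * b)"
  proof
    show "(\<lambda>(A, B). A \<inter> B) ` ?X \<subseteq> cocyclic_lattices (a * b)"
      using cocyclic_lattices_Int[OF ab] by auto
    show "cocyclic_lattices (a * b) \<subseteq> (\<lambda>(A, B). A \<inter> B) ` ?X"
      by (force simp: cocyclic_lattices_def congruence_lattice_mult[OF ab])
  qed
  ultimately show ?thesis by (metis card_image card_cartesian_product)
qed

lemma card_cocyclic_lattices_1: "card (cocyclic_lattices 1) = 1"
proof -
  have "congruence_lattice 1 u v = UNIV" for u v by (auto simp: congruence_lattice_def)
  moreover have "\<exists>u v :: int. coprime u v" by (rule exI[of _ 1]) simp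
  ultimately have "cocyclic_lattices 1 = {UNIV}" unfolding cocyclic_lattices_def by auto
  then show ?thesis by simp
qed

text \<open>
  Coprime coefficients are not both divisible by \<open>p\<close>, so one of them can be scaled to 1 modulo
  \<open>p ^ s\<close>. Preferring the first one, the second family is left with first coefficients divisible by \<open>p\<close>;
  these are multiples \<open>p * x\<close>, with \<open>x\<close> determined only modulo \<open>p ^ (s - 1)\<close>.
\<close>

lemma cocyclic_lattices_prime_power:
  fixes p :: int
  assumes p: "prime p" and s: "0 < s"
  shows "cocyclic_lattices (p ^ s) =
    (\<lambda>y. congruence_lattice (p ^ s) 1 y) ` {0..<p ^ s} \<union>
    (\<lambda>x. congruence_lattice (p ^ s) (p * x) 1) ` {0..<p ^ (s - 1)}" (is "_ = ?F \<union> ?G")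
proof
  let ?e = "p ^ s"
  have ppos: "0 < p" using p by (simp add: prime_gt_0_int)
  have ps: "?e = p * p ^ (s - 1)" using s by (simp add: power_eq_if)
  show "?F \<union> ?G \<subseteq> cocyclic_lattices ?e"
    by (auto simp: cocyclic_lattices_def) (metis coprime_1_left coprime_1_right)+
  show "cocyclic_lattices ?e \<subseteq> ?F \<union> ?G"
  proof
    fix M assume "M \<in> cocyclic_lattices ?e"
    then obtain u v where M: "M = congruence_lattice ?e u v" and uv: "coprime u v"
      by (auto simp: cocyclic_lattices_def)
    show "M \<in> ?F \<union> ?G"
    proof (cases "p dvd u")
      case False
      then have "coprime u ?e" using p by (metis coprime_commute coprime_power_right_iff prime_imp_coprime)
      then obtain w where w: "[u * w = 1] (mod ?e)" using cong_solve_coprime_int by blast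
      let ?y = "(v * w) mod ?e"
      have "?e dvd v * (u * w - 1)" using w by (simp add: cong_iff_dvd_diff)
      then have "M = congruence_lattice ?e 1 (v * w)"
        unfolding M using uv by (subst congruence_lattice_eq_iff) (auto simp: algebra_simps)
      also have "\<dots> = congruence_lattice ?e 1 ?y"
        by (rule congruence_lattice_cong) simp_all
      finally show ?thesis using ppos by auto
    next
      case True
      then have "\<not> p dvd v" using uv p by (metis coprime_common_divisor not_prime_unit)
      then have "coprime v ?e" using p by (metis coprime_commute coprime_power_right_iff prime_imp_coprime)
      then obtain w where w: "[v * w = 1] (mod ?e)" using cong_solve_coprime_int by blast
      obtain u' where u': "u = p * u'" using True by blast
      let ?x = "(u' * w) mod p ^ (s - 1)"
      have "?e dvd u * (1 - v * w)" using w by (metis cong_iff_dvd_diff cong_sym dvd_mult)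
      then have "M = congruence_lattice ?e (u * w) 1"
        unfolding M using uv by (subst congruence_lattice_eq_iff) (auto simp: algebra_simps)
      also have "\<dots> = congruence_lattice ?e (p * ?x) 1"
      proof (rule congruence_lattice_cong)
        have "p * ?x = (u * w) mod ?e" unfolding u' ps by (simp only: mult.assoc mod_mult_mult1)
        then show "[u * w = p * ?x] (mod ?e)" by simp
      qed simp
      finally show ?thesis using ppos by auto
    qed
  qed
qed

text \<open>
  The determinant criterion shows that the representatives are pairwise inequivalent: the
  determinant is \<open>y - x\<close> within the first family, \<open>p * (x - y)\<close> within the second, and congruent to 1
  modulo \<open>p\<close> between the families.
\<close>

lemma card_cocyclic_lattices_prime_power:
  fixes p :: int
  assumes p: "prime p" and s: "0 < s"
  shows "card (cocyclic_lattices (p ^ s)) = nat p ^ s + nat p ^ (s - 1)"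
proof -
  let ?e = "p ^ s"
  let ?F = "(\<lambda>y. congruence_lattice ?e 1 y)" and ?G = "(\<lambda>x. congruence_lattice ?e (p * x) 1)"
  have ppos: "0 < p" using p by (simp add: prime_gt_0_int)
  have ps: "?e = p * p ^ (s - 1)" using s by (simp add: power_eq_if)
  have small: "x = y" if "0 \<le> x" "x < n" "0 \<le> y" "y < n" "n dvd y - x" for x y n :: int
    using that by (metis mod_eq_dvd_iff mod_pos_pos_trivial)
  have F: "inj_on ?F {0..<?e}"
  proof (rule inj_onI)
    fix x y assume xy: "x \<in> {0..<?e}" "y \<in> {0..<?e}" and "?F x = ?F y"
    then have "?e dvd y - x" by (subst (asm) congruence_lattice_eq_iff) auto
    then show "x = y" using small[of x ?e y] xy by auto
  qed
  have G: "inj_on ?G {0..<p ^ (s - 1)}"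
  proof (rule inj_onI)
    fix x y assume xy: "x \<in> {0..<p ^ (s - 1)}" "y \<in> {0..<p ^ (s - 1)}" and "?G x = ?G y"
    then have "?e dvd p * x - p * y" by (subst (asm) congruence_lattice_eq_iff) auto
    then have "p ^ (s - 1) dvd x - y" using ppos unfolding ps by (simp flip: right_diff_distrib)
    then show "x = y" using small[of y _ x] xy by auto
  qed
  have FG: "?F ` {0..<?e} \<inter> ?G ` {0..<p ^ (s - 1)} = {}"
  proof -
    have "?F y \<noteq> ?G x" for x y
    proof
      assume "?F y = ?G x"
      then have "?e dvd 1 - y * (p * x)" by (subst (asm) congruence_lattice_eq_iff) auto
      then have "p dvd 1 - p * (y * x)" using ps by (metis dvd_mult_left mult.left_commute)
      then have "p dvd 1 - p * (y * x) + p * (y * x)" by (intro dvd_add) auto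
      then show False using p by (simp add: not_prime_unit)
    qed
    then show ?thesis by auto
  qed
  show ?thesis
    unfolding cocyclic_lattices_prime_power[OF p s]
    by (subst card_Un_disjoint[OF _ _ FG])
      (use ppos in \<open>simp_all add: card_image[OF F] card_image[OF G] nat_power_eq del: One_nat_def\<close>)
qed

lemma card_cocyclic_lattices_prod:
  fixes p s :: "'i \<Rightarrow> nat"
  assumes "finite I" "inj_on p I" "\<And>k. k \<in> I \<Longrightarrow> prime (p k)"
  shows "card (cocyclic_lattices (int (\<Prod>k\<in>I. p k ^ s k))) =
    (\<Prod>k\<in>I. card (cocyclic_lattices (int (p k) ^ s k)))"
  using assms
proof (induction I rule: finite_induct)
  case empty
  then show ?case by (simp add: card_cocyclic_lattices_1)
next
  case (insert k I)
  have "coprime (p k ^ s k) (\<Prod>j\<in>I. p j ^ s j)"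
  proof (rule prod_coprime_right)
    fix j assume j: "j \<in> I"
    then have "p k \<noteq> p j" using insert by auto
    then have "coprime (p k) (p j)" using insert j by (intro primes_coprime) auto
    then show "coprime (p k ^ s k) (p j ^ s j)" by simp
  qed
  then have "coprime (int (p k ^ s k)) (int (\<Prod>j\<in>I. p j ^ s j))"
    by (simp only: coprime_int_iff)
  from card_cocyclic_lattices_mult[OF this] insert show ?case
    by (simp del: of_nat_prod)
qed

section \<open>Counting a unimodular class\<close>

text \<open>
  Let \<open>(a, b)\<close> and \<open>(a', b')\<close> be the coordinates of a basis of \<open>L\<close>. The form \<open>- b x + a y\<close> vanishes at
  \<open>(a, b)\<close> and takes the unit value \<open>a b' - b a'\<close> at \<open>(a', b')\<close>, so up to sign it is the second
  coordinate in that basis. Adapted sublattices are therefore scaled congruence lattices.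
  Conversely, every coprime pair of coefficients arises, by completing it to a unimodular matrix with
  Bezout coefficients.
\<close>

lemma adapted_eq_image_cocyclic:
  assumes L: "basis2 L u v" and "0 < d" "0 < e"
  shows "adapted_sublattices L d (d * e) =
    (\<lambda>X. (\<lambda>(x, y). of_nat d *\<^sub>R (of_int x *\<^sub>R u + of_int y *\<^sub>R v)) ` X) ` cocyclic_lattices (int e)"
    (is "_ = (\<lambda>X. ?f ` X) ` _")
proof -
  have key: "int_span (of_nat d *\<^sub>R (of_int a *\<^sub>R u + of_int b *\<^sub>R v))
        (of_nat (d * e) *\<^sub>R (of_int a' *\<^sub>R u + of_int b' *\<^sub>R v))
      = ?f ` congruence_lattice (int e) (-b) a" if det: "is_unit (a * b' - b * a')" for a b a' b'
  proof (intro equalityI subsetI)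
    fix z assume "z \<in> int_span (of_nat d *\<^sub>R (of_int a *\<^sub>R u + of_int b *\<^sub>R v))
        (of_nat (d * e) *\<^sub>R (of_int a' *\<^sub>R u + of_int b' *\<^sub>R v))"
    then obtain x y where z: "z = of_int x *\<^sub>R (of_nat d *\<^sub>R (of_int a *\<^sub>R u + of_int b *\<^sub>R v)) +
        of_int y *\<^sub>R (of_nat (d * e) *\<^sub>R (of_int a' *\<^sub>R u + of_int b' *\<^sub>R v))"
      by (auto simp: int_span_def)
    let ?w = "(x * a + int e * y * a', x * b + int e * y * b')"
    have "z = ?f ?w" by (simp add: z algebra_simps)
    moreover have "(-b) * fst ?w + a * snd ?w = int e * (y * (a * b' - b * a'))"
      by (simp add: algebra_simps)
    then have "?w \<in> congruence_lattice (int e) (-b) a" by (simp add: congruence_lattice_def)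
    ultimately show "z \<in> ?f ` congruence_lattice (int e) (-b) a" by blast
  next
    fix z assume "z \<in> ?f ` congruence_lattice (int e) (-b) a"
    then obtain x y k where z: "z = ?f (x, y)" and k: "-b * x + a * y = int e * k"
      unfolding congruence_lattice_def by (elim imageE CollectE case_prodE dvdE) blast
    obtain q where q: "1 = (a * b' - b * a') * q" using det by (rule dvdE)
    \<comment> \<open>Coordinates in the new basis by Cramer's rule; \<open>q\<close> is the inverse of the determinant, and \<open>e\<close> is already divided out of \<open>?y\<close>.\<close>
    let ?x = "q * (b' * x - a' * y)" and ?y = "q * k"
    have "?x * a + int e * ?y * a' = q * (b' * x - a' * y) * a + (int e * k) * q * a'" by algebra
    also have "\<dots> = ((a * b' - b * a') * q) * x" unfolding k[symmetric] by algebra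
    finally have x: "x = ?x * a + int e * ?y * a'" using q by simp
    have "?x * b + int e * ?y * b' = q * (b' * x - a' * y) * b + (int e * k) * q * b'" by algebra
    also have "\<dots> = ((a * b' - b * a') * q) * y" unfolding k[symmetric] by algebra
    finally have y: "y = ?x * b + int e * ?y * b'" using q by simp
    have "z = ?f (?x * a + int e * ?y * a', ?x * b + int e * ?y * b')"
      using z x y by simp
    also have "\<dots> = of_int ?x *\<^sub>R (of_nat d *\<^sub>R (of_int a *\<^sub>R u + of_int b *\<^sub>R v)) +
        of_int ?y *\<^sub>R (of_nat (d * e) *\<^sub>R (of_int a' *\<^sub>R u + of_int b' *\<^sub>R v))"
      by (simp add: algebra_simps)
    finally show "z \<in> int_span (of_nat d *\<^sub>R (of_int a *\<^sub>R u + of_int b *\<^sub>R v))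
        (of_nat (d * e) *\<^sub>R (of_int a' *\<^sub>R u + of_int b' *\<^sub>R v))"
      using int_spanI by metis
  qed
  show ?thesis
  proof (intro equalityI subsetI)
    fix M assume "M \<in> adapted_sublattices L d (d * e)"
    then obtain u' v' where L': "basis2 L u' v'"
      and M: "M = int_span (of_nat d *\<^sub>R u') (of_nat (d * e) *\<^sub>R v')"
      by (auto simp: adapted_sublattices_def)
    obtain a b a' b' where e: "u' = of_int a *\<^sub>R u + of_int b *\<^sub>R v"
        "v' = of_int a' *\<^sub>R u + of_int b' *\<^sub>R v" and det: "is_unit (a * b' - b * a')"
      using basis2_change_unimodular[OF L L'] by blast
    have "coprime (-b) a"
    proof (rule coprimeI)
      fix c assume "c dvd -b" "c dvd a"
      then have "c dvd a * b' - b * a'" by simp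
      then show "is_unit c" using det by (rule dvd_trans)
    qed
    then have "congruence_lattice (int e) (-b) a \<in> cocyclic_lattices (int e)"
      unfolding cocyclic_lattices_def by blast
    then show "M \<in> (\<lambda>X. ?f ` X) ` cocyclic_lattices (int e)"
      unfolding M e key[OF det] by (rule imageI)
  next
    fix M assume "M \<in> (\<lambda>X. ?f ` X) ` cocyclic_lattices (int e)"
    then obtain r s where M: "M = ?f ` congruence_lattice (int e) r s" and "coprime r s"
      by (auto simp: cocyclic_lattices_def)
    then obtain i j where ij: "i * r + j * s = 1" by (metis bezout_int coprime_imp_gcd_eq_1)
    have det: "is_unit (s * j - (-r) * i)" using ij by (simp add: algebra_simps)
    show "M \<in> adapted_sublattices L d (d * e)"
      using key[OF det] basis2_unimodular[OF L det] unfolding M adapted_sublattices_def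
      by force
  qed
qed

lemma card_adapted_sublattices:
  assumes L: "is_lattice2 L" and d: "0 < d" and e: "0 < e"
  shows "card (adapted_sublattices L d (d * e)) = card (cocyclic_lattices (int e))"
proof -
  obtain u v where uv: "basis2 L u v" using L by (auto simp: is_lattice2_iff_basis2)
  let ?f = "\<lambda>(x, y). of_nat d *\<^sub>R (of_int x *\<^sub>R u + of_int y *\<^sub>R v)"
  have "inj ?f"
  proof (rule injI, clarify)
    fix x y x' y' :: int
    assume "of_nat d *\<^sub>R (of_int x *\<^sub>R u + of_int y *\<^sub>R v) = of_nat d *\<^sub>R (of_int x' *\<^sub>R u + of_int y' *\<^sub>R v)"
    then have "of_int x *\<^sub>R u + of_int y *\<^sub>R v = of_int x' *\<^sub>R u + of_int y' *\<^sub>R v"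
      using d by simp
    then show "x = x' \<and> y = y'"
      using uv indep2_coords_unique[of u v] by (fastforce simp: basis2_def)
  qed
  then have "inj_on (\<lambda>X. ?f ` X) (cocyclic_lattices (int e))"
    by (intro inj_onI) (simp add: inj_image_eq_iff)
  then show ?thesis
    unfolding adapted_eq_image_cocyclic[OF uv d e] by (rule card_image)
qed

theorem corollary3p1:
  fixes \<Lambda> :: "'a::euclidean_space set"
    and l m m1 m2 :: nat
    and p r t :: "nat \<Rightarrow> nat"
  assumes "is_lattice2 \<Lambda>"
    and "\<And>k. k \<in> {1..l} \<Longrightarrow> prime (p k)"
    and "inj_on p {1..l}"
    and "m = (\<Prod>k=1..l. p k ^ r k)"
    and "\<And>k. k \<in> {1..l} \<Longrightarrow> 2 * t k \<le> r k"
    and "m1 = (\<Prod>k=1..l. p k ^ t k)"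
    and "m2 = (\<Prod>k=1..l. p k ^ (r k - t k))"
  shows "class_size \<Lambda> m1 m2 =
    (\<Prod>k\<in>{k\<in>{1..l}. 2 * t k \<noteq> r k}. p k ^ (r k - 2 * t k) + p k ^ (r k - 2 * t k - 1))"
proof -
  define e where "e = (\<Prod>k=1..l. p k ^ (r k - 2 * t k))"
  have "m2 = (\<Prod>k=1..l. p k ^ t k * p k ^ (r k - 2 * t k))"
    unfolding assms(7)
  proof (rule prod.cong[OF refl])
    fix k assume "k \<in> {1..l}"
    then have "r k - t k = t k + (r k - 2 * t k)" using assms(5)[of k] by linarith
    then show "p k ^ (r k - t k) = p k ^ t k * p k ^ (r k - 2 * t k)"
      by (simp only: power_add)
  qed
  then have m2: "m2 = m1 * e" by (simp add: assms(6) e_def prod.distrib)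
  have pos: "0 < m1" "0 < e"
    using assms(2) by (auto simp: assms(6) e_def intro!: prod_pos prime_gt_0_nat)
  have "class_size \<Lambda> m1 m2 = card (adapted_sublattices \<Lambda> m1 m2)"
    using unimodular_class_eq_adapted[OF assms(1)] pos by (simp add: class_size_def m2)
  also have "\<dots> = card (cocyclic_lattices (int e))"
    unfolding m2 by (rule card_adapted_sublattices[OF assms(1) pos])
  also have "\<dots> = (\<Prod>k=1..l. card (cocyclic_lattices (int (p k) ^ (r k - 2 * t k))))"
    unfolding e_def by (rule card_cocyclic_lattices_prod) (use assms(2,3) in auto)
  also have "\<dots> = (\<Prod>k=1..l. if 2 * t k \<noteq> r k
      then p k ^ (r k - 2 * t k) + p k ^ (r k - 2 * t k - 1) else 1)"
  proof (rule prod.cong[OF refl])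
    fix k assume k: "k \<in> {1..l}"
    then show "card (cocyclic_lattices (int (p k) ^ (r k - 2 * t k))) = (if 2 * t k \<noteq> r k
      then p k ^ (r k - 2 * t k) + p k ^ (r k - 2 * t k - 1) else 1)"
      using assms(2,5)[OF k] card_cocyclic_lattices_prime_power[of "int (p k)" "r k - 2 * t k"]
      by (auto simp: card_cocyclic_lattices_1)
  qed
  also have "\<dots> = (\<Prod>k\<in>{k\<in>{1..l}. 2 * t k \<noteq> r k}. p k ^ (r k - 2 * t k) + p k ^ (r k - 2 * t k - 1))"
    by (rule prod.inter_filter[symmetric]) simp
  finally show ?thesis .
qed

end
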